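(* Let $X$ be a linear 2-normed space over $\mathbb{K}$ ($\mathbb{K}=\mathbb{R}$ or $\mathbb{C}$) and let $b\in X$ be fixed. Then every bounded b-linear functional defined on $X\times\langle b\rangle$ is b-sequentially continuous (at every point of $X$).
   Context: Let $X$ be a linear space of dimension greater than $1$ over $\mathbb{K}$. A 2-norm on $X$ is a function $\|\cdot,\cdot\|:X\times X\to\mathbb{R}$ such that: (N1) $\|x,y\|=0$ if and only if $x,y$ are linearly dependent; (N2) $\|x,y\|=\|y,x\|$; (N3) $\|\alpha x,y\|=|\alpha|\,\|x,y\|$ for all $\alpha\in\mathbb{K}$; (N4) $\|x,y+z\|\le\|x,y\|+\|x,z\|$. The pair $(X,\|\cdot,\cdot\|)$ is then called a linear 2-normed space. A sequence $\{x_n\}$ in $X$ converges to $x\in X$ if $\lim_{n\to\infty}\|x_n-x,y\|=0$ for every $y\in X$. For fixed $b\in X$, $\langle b\rangle$ is the subspace of $X$ generated by $b$. A b-linear functional on $X\times\langle b\rangle$ is a map $T:X\times\langle b\rangle\to\mathbb{K}$ with $T(x+y,b)=T(x,b)+T(y,b)$ and $T(kx,b)=kT(x,b)$ for all $x,y\in X$, $k\in\mathbb{K}$. It is bounded if there is $M>0$ with $|T(x,b)|\le M\|x,b\|$ for all $x\in X$. A b-linear functional $T$ on $X\times\langle b\rangle$ is b-sequentially continuous at $x\in X$ if for every sequence $\{x_n\}$ converging to $x$ in $X$, the sequence $\{T(x_n,b)\}$ converges to $T(x,b)$ in $\mathbb{K}$. *)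

theory Defs
  imports "HOL-Analysis.Analysis"
begin

(* The scalar field is a type of class real_normed_field. Its instances include real and
   complex, and by Mazur's theorem every such field is isometrically isomorphic to one of
   these two. The scalar absolute value is norm. *)

(* Linear dependence of the family (x, y). This differs from the library's dependent {x, y},
   which concerns sets: for x = y the set collapses to {x}, independent if x is nonzero,
   whereas the family (x, x) is always dependent. *)
definition linearly_dependent_pair ::
  "('k::real_normed_field \<Rightarrow> 'a::ab_group_add \<Rightarrow> 'a) \<Rightarrow> 'a \<Rightarrow> 'a \<Rightarrow> bool" where
  "linearly_dependent_pair smul x y \<longleftrightarrow>
     (\<exists>\<alpha> \<beta>. (\<alpha> \<noteq> 0 \<or> \<beta> \<noteq> 0) \<and> smul \<alpha> x + smul \<beta> y = 0)"

(* X is the whole type 'a. The library's dim is 0 for infinite-dimensional spaces, so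
   "dimension greater than 1" is stated through a (possibly infinite) basis. *)
locale linear_2_normed_space = vector_space smul
  for smul :: "'k::real_normed_field \<Rightarrow> 'a::ab_group_add \<Rightarrow> 'a" +
  fixes norm2 :: "'a \<Rightarrow> 'a \<Rightarrow> real"
  assumes dim_gt_1: "\<exists>B. \<not> module.dependent smul B \<and> module.span smul B = UNIV \<and> (infinite B \<or> 1 < card B)"
    and norm2_eq_0_iff: "norm2 x y = 0 \<longleftrightarrow> linearly_dependent_pair smul x y"
    and norm2_commute: "norm2 x y = norm2 y x"
    and norm2_scale: "norm2 (smul \<alpha> x) y = norm \<alpha> * norm2 x y"
    and norm2_triangle: "norm2 x (y + z) \<le> norm2 x y + norm2 x z"

definition converges2 ::
  "('a::ab_group_add \<Rightarrow> 'a \<Rightarrow> real) \<Rightarrow> (nat \<Rightarrow> 'a) \<Rightarrow> 'a \<Rightarrow> bool" where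
  "converges2 norm2 s x \<longleftrightarrow> (\<forall>y. (\<lambda>n. norm2 (s n - x) y) \<longlonglongrightarrow> 0)"

(* A map on X \<times> \<langle>b\<rangle> is represented by a total function on 'a \<times> 'a. Its values outside
   UNIV \<times> span {b} are unconstrained and never used; the notions below involve only the
   values at the points (x, b). *)

definition b_linear_functional ::
  "('k::real_normed_field \<Rightarrow> 'a::ab_group_add \<Rightarrow> 'a) \<Rightarrow> 'a \<Rightarrow> ('a \<times> 'a \<Rightarrow> 'k) \<Rightarrow> bool" where
  "b_linear_functional smul b T \<longleftrightarrow>
     (\<forall>x y. T (x + y, b) = T (x, b) + T (y, b)) \<and>
     (\<forall>k x. T (smul k x, b) = k * T (x, b))"

definition b_bounded ::
  "('a::ab_group_add \<Rightarrow> 'a \<Rightarrow> real) \<Rightarrow> 'a \<Rightarrow> ('a \<times> 'a \<Rightarrow> 'k::real_normed_field) \<Rightarrow> bool" where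
  "b_bounded norm2 b T \<longleftrightarrow> (\<exists>M>0. \<forall>x. norm (T (x, b)) \<le> M * norm2 x b)"

definition b_sequentially_continuous_at ::
  "('a::ab_group_add \<Rightarrow> 'a \<Rightarrow> real) \<Rightarrow> 'a \<Rightarrow> ('a \<times> 'a \<Rightarrow> 'k::real_normed_field) \<Rightarrow> 'a \<Rightarrow> bool" where
  "b_sequentially_continuous_at norm2 b T x \<longleftrightarrow>
     (\<forall>s. converges2 norm2 s x \<longrightarrow> (\<lambda>n. T (s n, b)) \<longlonglongrightarrow> T (x, b))"

end

theory Submission
  imports Defs
begin

text \<open>Additivity reduces continuity at \<open>x\<close> to continuity at 0: the error T(s n,
  b) - T(x, b) equals T(s n - x, b). Boundedness dominates its norm by
  \<open>M * norm2 (s n - x) b\<close>, and this tends to 0 because convergence in the 2-norm is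
  tested against every vector, in particular against \<open>b\<close>. The claim follows by
  squeezing.\<close>

theorem theorem4p4:
  fixes smul :: "'k::real_normed_field \<Rightarrow> 'a::ab_group_add \<Rightarrow> 'a"
    and norm2 :: "'a \<Rightarrow> 'a \<Rightarrow> real"
    and b :: 'a
    and T :: "'a \<times> 'a \<Rightarrow> 'k"
  assumes "linear_2_normed_space smul norm2"
    and "b_linear_functional smul b T"
    and "b_bounded norm2 b T"
  shows "\<forall>x. b_sequentially_continuous_at norm2 b T x"
proof (intro allI, unfold b_sequentially_continuous_at_def, intro allI impI)
  fix x :: 'a and s :: "nat \<Rightarrow> 'a"
  assume "converges2 norm2 s x"
  \<comment> \<open>The test vector is taken to be \<open>b\<close>, the second argument in the
    bound on \<open>T\<close>.\<close>
  then have lim: "(\<lambda>n. norm2 (s n - x) b) \<longlonglongrightarrow> 0"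
    by (simp add: converges2_def)
  obtain M where bound: "\<And>z. norm (T (z, b)) \<le> M * norm2 z b"
    using assms(3) by (auto simp: b_bounded_def)
  have T_add: "T (y + z, b) = T (y, b) + T (z, b)" for y z
    using assms(2) by (simp add: b_linear_functional_def)
  \<comment> \<open>Splitting \<open>s n\<close> as \<open>(s n - x) + x\<close> yields the
    difference from additivity alone, without a rule for negatives.\<close>
  have T_diff: "T (s n, b) - T (x, b) = T (s n - x, b)" for n
    using T_add[of "s n - x" x] by simp
  have "(\<lambda>n. T (s n - x, b)) \<longlonglongrightarrow> 0"
  proof (rule Lim_null_comparison)
    show "\<forall>\<^sub>F n in sequentially. norm (T (s n - x, b)) \<le> M * norm2 (s n - x) b"
      by (simp add: bound)
    show "(\<lambda>n. M * norm2 (s n - x) b) \<longlonglongrightarrow> 0"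
      using lim by (rule tendsto_mult_right_zero)
  qed
  then show "(\<lambda>n. T (s n, b)) \<longlonglongrightarrow> T (x, b)"
    \<comment> \<open>The rewriting acts on the chained limit, turning it back into a difference of
      values that tends to 0.\<close>
    unfolding T_diff[symmetric] by (rule LIM_zero_cancel)
qed

end
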